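(* For every $s\in\mathbb{C}$ with $2^{1-s}\ne1$, the Riemann zeta function satisfies $$\zeta(s)=\sum_{n=0}^\infty\bigg[\sum_{k=0}^n P_k(n)\,\frac{1-2^{1-k}}{1-2^{1-s}}\,\zeta(k)\bigg]P_n(s).$$
   Context: For $n\in\mathbb{Z}_{\ge 0}$ and $s\in\mathbb{C}$, $P_n(s)=(-1)^n\binom{s}{n}=\frac{(-1)^n}{n!}\prod_{m=0}^{n-1}(s-m)$. $\zeta$ is the (analytically continued) Riemann zeta function. For $k=1$ the product $(1-2^{1-k})\zeta(k)$ is understood as its limiting value $\lim_{s\to1}(1-2^{1-s})\zeta(s)$. *)

theory Defs
  imports "HOL-Complex_Analysis.Complex_Analysis"
begin

text \<open>
  The Riemann zeta function: the unique analytic continuation to \<open>\<complex> - {1}\<close> of the Dirichlet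
  series \<open>\<Sum> 1 / n\<^sup>s\<close> (\<open>n \<ge> 1\<close>, \<open>Re s > 1\<close>). The junk value \<open>0\<close> at the pole only serves to make the
  function unique on the whole type.
\<close>
definition riemann_zeta :: "complex \<Rightarrow> complex" where
  "riemann_zeta = (THE f.
     f holomorphic_on (- {1}) \<and>
     (\<forall>s. Re s > 1 \<longrightarrow> (\<lambda>n. 1 / of_nat (Suc n) powr s) sums f s) \<and>
     f 1 = 0)"

definition newton_P :: "nat \<Rightarrow> complex \<Rightarrow> complex" where
  "newton_P n s = (-1) ^ n * (s gchoose n)"

text \<open>
  The product \<open>(1 - 2\<^bsup>1-k\<^esup>) \<zeta>(k)\<close>, which at the pole \<open>k = 1\<close> is read as its limiting value.
\<close>
definition zeta_factor :: "nat \<Rightarrow> complex" where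
  "zeta_factor k =
     (if k = 1 then Lim (at 1) (\<lambda>s. (1 - 2 powr (1 - s)) * riemann_zeta s)
      else (1 - 2 powr (1 - of_nat k)) * riemann_zeta (of_nat k))"

end

theory Submission
  imports Defs
begin

text \<open>
  Write \<open>\<eta>(s) = (1 - 2\<^bsup>1-s\<^esup>) \<zeta>(s)\<close> and regularise it as the Abel sum
  \<open>\<eta>\<^sub>r(s) = \<Sum> (-r)\<^bsup>m-1\<^esup> m\<^bsup>-s\<^esup>\<close> (\<open>m \<ge> 1\<close>, \<open>0 < r < 1\<close>). Expanding
  \<open>m\<^bsup>-s\<^esup> = (1 - (1 - 1/m))\<^bsup>s\<^esup> = \<Sum> P\<^sub>n(s) (1 - 1/m)\<^bsup>n\<^esup>\<close> by the binomial series is harmless for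
  \<open>r < 1\<close> and gives \<open>\<eta>\<^sub>r(s) = \<Sum> a\<^sub>n(r) P\<^sub>n(s)\<close> with
  \<open>a\<^sub>n(r) = \<Sum> (-r)\<^bsup>m-1\<^esup> (1 - 1/m)\<^bsup>n\<^esup> = \<Sum> P\<^sub>k(n) \<eta>\<^sub>r(k)\<close> (\<open>k \<le> n\<close>). It remains to let \<open>r\<close> tend
  to \<open>1\<close>. Repeated summation by parts (the Euler transform) writes an Abel sum in terms of
  higher differences of the summand, and Cauchy's estimates for these differences show that
  \<open>\<eta>\<^sub>r \<rightarrow> \<eta>\<close> everywhere, and that \<open>a\<^sub>n(r)\<close> decays faster than any power of \<open>n\<close>, uniformly in \<open>r\<close>;
  since \<open>P\<^sub>n(s)\<close> grows at most polynomially, dominated convergence applies.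

  The same argument continues the Dirichlet series with coefficients \<open>x\<^bsup>m-1\<^esup>\<close> for every \<open>x \<noteq> 1\<close> on
  the unit circle. Cube roots of unity give \<open>(1 - 3\<^bsup>1-s\<^esup>) \<zeta>(s)\<close>, and as \<open>1 - 2\<^bsup>1-s\<^esup>\<close> and
  \<open>1 - 3\<^bsup>1-s\<^esup>\<close> vanish simultaneously only at \<open>s = 1\<close>, the two together yield the existence of the
  continuation of \<open>\<zeta>\<close>.
\<close>

section \<open>Forward differences and the Euler transform\<close>

definition fdiff :: "(complex \<Rightarrow> complex) \<Rightarrow> complex \<Rightarrow> complex" where
  "fdiff f z = f (z + 1) - f z"

lemma fdiff_funpow_Suc: "(fdiff ^^ Suc n) f z = (fdiff ^^ n) f (z + 1) - (fdiff ^^ n) f z"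
  by (simp add: fdiff_def)

lemma holomorphic_on_shift_halfplane:
  assumes "f holomorphic_on {z. Re z > 0}"
  shows "(\<lambda>z. f (z + 1)) holomorphic_on {z. Re z > 0}"
proof -
  have "f \<circ> (\<lambda>z. z + 1) holomorphic_on {z. Re z > 0}"
    by (rule holomorphic_on_compose_gen[OF _ assms]) (auto intro!: holomorphic_intros)
  then show ?thesis by (simp add: o_def)
qed

text \<open>The mean value inequality, applied \<open>n\<close> times: each difference costs one
  derivative and lengthens the segment to be controlled by 1.\<close>

lemma norm_fdiff_le_higher_deriv:
  assumes "f holomorphic_on {z. Re z > 0}" "x > 0"
    and "\<And>y. x \<le> y \<Longrightarrow> y \<le> x + real n \<Longrightarrow> norm ((deriv ^^ n) f (of_real y)) \<le> B"
  shows "norm ((fdiff ^^ n) f (of_real x)) \<le> B"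
  using assms
proof (induction n arbitrary: f)
  case 0
  then show ?case by (metis add_0_right funpow_0 id_apply of_nat_0 order_refl)
next
  case (Suc n)
  let ?H = "{z. Re z > 0}"
  have opH: "open ?H" by (rule open_halfspace_Re_gt)
  note hol = Suc.prems(1)
  note hol' = holomorphic_on_shift_halfplane[OF hol]
  have fd: "fdiff f = (\<lambda>z. f (z + 1) - f z)"
    by (auto simp: fdiff_def)
  \<comment> \<open>The innermost difference is split off, so that the induction hypothesis, general
    in \<open>f\<close>, applies to \<open>fdiff f\<close>.\<close>
  have "norm ((fdiff ^^ n) (fdiff f) (of_real x)) \<le> B"
  proof (rule Suc.IH)
    show "fdiff f holomorphic_on ?H"
      unfolding fd by (intro holomorphic_intros hol hol')
    fix y assume y: "x \<le> y" "y \<le> x + real n"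
    have yH: "of_real y \<in> ?H" using y \<open>x > 0\<close> by simp
    have "(deriv ^^ n) (\<lambda>w. f (1 * w + 1)) (of_real y) = 1 ^ n * (deriv ^^ n) f (1 * of_real y + 1)"
      by (rule higher_deriv_compose_linear'[OF hol opH opH yH]) auto
    then have shift: "(deriv ^^ n) (\<lambda>w. f (w + 1)) (of_real y) = (deriv ^^ n) f (of_real y + 1)"
      by simp
    have "(deriv ^^ n) (fdiff f) (of_real y)
        = (deriv ^^ n) (\<lambda>w. f (w + 1)) (of_real y) - (deriv ^^ n) f (of_real y)"
      unfolding fd by (rule higher_deriv_diff[OF hol' hol opH yH])
    also have "\<dots> = (deriv ^^ n) f (of_real (y + 1)) - (deriv ^^ n) f (of_real y)"
      by (simp add: shift)
    also have "norm \<dots> \<le> B * norm (of_real (y + 1) - of_real y :: complex)"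
    proof (rule field_differentiable_bound[of "closed_segment (of_real y) (of_real (y + 1))" _
            "(deriv ^^ Suc n) f"])
      fix z assume "z \<in> closed_segment (of_real y) (of_real (y + 1) :: complex)"
      then obtain u where u: "0 \<le> u" "u \<le> 1"
          and "z = (1 - u) *\<^sub>R of_real y + u *\<^sub>R of_real (y + 1)"
        by (auto simp: in_segment)
      then have z: "z = of_real (y + u)" by (simp add: scaleR_conv_of_real algebra_simps)
      have zH: "z \<in> ?H" using z y u \<open>x > 0\<close> by simp
      have "(deriv ^^ n) f holomorphic_on ?H"
        by (rule holomorphic_higher_deriv[OF hol opH])
      then show "((deriv ^^ n) f has_field_derivative (deriv ^^ Suc n) f z)
              (at z within closed_segment (of_real y) (of_real (y + 1)))"
        using holomorphic_derivI[OF _ opH zH] has_field_derivative_at_within by fastforce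
      show "norm ((deriv ^^ Suc n) f z) \<le> B"
        unfolding z using y u by (intro Suc.prems(3)) auto
    qed auto
    finally show "norm ((deriv ^^ n) (fdiff f) (of_real y)) \<le> B" by simp
  qed fact
  then show ?case by (simp add: funpow_swap1)
qed

text \<open>The regions \<open>cball x (x / 4)\<close> with \<open>x \<ge> 1\<close>, on which Cauchy's estimate is applied, all lie
  in the following sector.\<close>

definition sector :: "complex set" where
  "sector = {z. Re z \<ge> 3 / 4 \<and> \<bar>Im z\<bar> \<le> Re z}"

lemma sectorD:
  assumes "z \<in> sector"
  shows "3 / 4 \<le> norm z" "norm z \<le> 2 * Re z"
  using assms complex_Re_le_cmod[of z] cmod_le[of z] by (auto simp: sector_def)

text \<open>Cauchy's inequality on circles of radius \<open>y / 4\<close>, proportional to the base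
  point, makes every derivative, and hence every difference, gain a factor 1/x. Against growth of
  order \<open>p\<close>, \<open>n = p + 2\<close> differences leave a summable 1/x^2.\<close>

lemma norm_fdiff_le_power:
  assumes hol: "f holomorphic_on {z. Re z > 0}"
    and bd: "\<And>z. z \<in> sector \<Longrightarrow> norm (f z) \<le> B * norm z ^ p" and "B \<ge> 0"
  shows "norm ((fdiff ^^ n) f (of_nat (Suc i)))
       \<le> fact n * 4 ^ n * (2 * (real n + 1)) ^ p * B * real (Suc i) ^ p / real (Suc i) ^ n"
proof -
  define x where "x = real (Suc i)"
  have x: "x \<ge> 1" by (simp add: x_def)
  have "norm ((fdiff ^^ n) f (of_real x))
     \<le> fact n * (B * (2 * (real n + 1) * x) ^ p) / (x / 4) ^ n"
  proof (rule norm_fdiff_le_higher_deriv[OF hol])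
    fix y assume y: "x \<le> y" "y \<le> x + real n"
    have near: "\<bar>Re z - y\<bar> \<le> y / 4 \<and> \<bar>Im z\<bar> \<le> y / 4 \<and> norm z \<le> 5 * y / 4"
      if "norm (of_real y - z) \<le> y / 4" for z
    proof -
      have "\<bar>y - Re z\<bar> \<le> y / 4" "\<bar>Im z\<bar> \<le> y / 4"
        using that abs_Re_le_cmod[of "of_real y - z"] abs_Im_le_cmod[of "of_real y - z"] by auto
      moreover have "norm z \<le> y + y / 4"
        using that norm_triangle_ineq4[of "of_real y" "of_real y - z"] x y by simp
      ultimately show ?thesis by (simp add: abs_minus_commute)
    qed
    have "Re z > 0" if "z \<in> cball (of_real y) (y / 4)" for z
    proof -
      have "\<bar>Re z - y\<bar> \<le> y / 4" using near[of z] that by (simp add: dist_norm)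
      then show ?thesis using x y by linarith
    qed
    then have sub: "cball (of_real y) (y / 4) \<subseteq> {z. Re z > 0}" by blast
    have "norm ((deriv ^^ n) f (of_real y)) \<le> fact n * (B * (2 * (real n + 1) * x) ^ p) / (y / 4) ^ n"
    proof (rule Cauchy_inequality)
      show "f holomorphic_on ball (of_real y) (y / 4)"
        using hol sub by (meson ball_subset_cball holomorphic_on_subset)
      show "continuous_on (cball (of_real y) (y / 4)) f"
        using hol sub holomorphic_on_imp_continuous_on holomorphic_on_subset by blast
      fix z :: complex assume z: "norm (of_real y - z) = y / 4"
      have zs: "z \<in> sector"
      proof -
        have "\<bar>Re z - y\<bar> \<le> y / 4" "\<bar>Im z\<bar> \<le> y / 4" using near[of z] z by auto
        then have "Re z \<ge> 3 / 4" "\<bar>Im z\<bar> \<le> Re z" using x y by linarith+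
        then show ?thesis by (simp add: sector_def)
      qed
      have nx: "real n \<le> real n * x" using x by (simp add: mult_le_cancel_left1)
      have "norm z \<le> 5 * (x + real n) / 4" using near[of z] z y by auto
      also have "\<dots> \<le> 2 * (real n + 1) * x"
        using nx x by (simp add: algebra_simps)
      finally have "norm z ^ p \<le> (2 * (real n + 1) * x) ^ p" by (intro power_mono) auto
      then show "norm (f z) \<le> B * (2 * (real n + 1) * x) ^ p"
        using bd[OF zs] \<open>B \<ge> 0\<close> by (meson mult_left_mono order_trans)
    qed (use x y in auto)
    also have "\<dots> \<le> fact n * (B * (2 * (real n + 1) * x) ^ p) / (x / 4) ^ n"
      using x y \<open>B \<ge> 0\<close> by (intro divide_left_mono power_mono mult_nonneg_nonneg mult_pos_pos) auto
    finally show "norm ((deriv ^^ n) f (of_real y)) \<le> \<dots>" .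
  qed (use x in auto)
  also have "\<dots> = fact n * 4 ^ n * (2 * (real n + 1)) ^ p * B * x ^ p / x ^ n"
    by (simp only: power_mult_distrib power_divide divide_divide_eq_right mult_ac)
  finally show ?thesis by (simp add: x_def)
qed

section \<open>Iterated summation by parts and its radial limit\<close>

definition abel_sum :: "complex \<Rightarrow> (complex \<Rightarrow> complex) \<Rightarrow> complex" where
  "abel_sum x f = (\<Sum>i. x ^ i * f (of_nat (Suc i)))"

text \<open>The outcome of \<open>n\<close> summations by parts. It stays meaningful on the unit
  circle away from 1 as soon as the \<open>n\<close>-th differences are summable, even where the
  original series diverges; for \<open>n = 0\<close> it is the original series.\<close>

definition euler_sum :: "nat \<Rightarrow> (complex \<Rightarrow> complex) \<Rightarrow> complex \<Rightarrow> complex" where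
  "euler_sum n f x = (\<Sum>j<n. x ^ j * (fdiff ^^ j) f 1 / (1 - x) ^ Suc j)
     + (x / (1 - x)) ^ n * abel_sum x ((fdiff ^^ n) f)"

text \<open>Shifting the series by one index and dividing by \<open>x\<close> produces f(i+2) next
  to x^i; subtracting the original series leaves the differences, and the resulting linear equation
  is solved for the Abel sum.\<close>

lemma abel_sum_fdiff:
  assumes "summable (\<lambda>i. x ^ i * f (of_nat (Suc i)))" "x \<noteq> 0" "x \<noteq> 1"
  shows "summable (\<lambda>i. x ^ i * fdiff f (of_nat (Suc i)))"
    and "abel_sum x f = f 1 / (1 - x) + x / (1 - x) * abel_sum x (fdiff f)"
proof -
  define F where "F = (\<lambda>i. x ^ i * f (of_nat (Suc i)))"
  have F: "F sums abel_sum x f"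
    using assms(1) by (simp add: F_def abel_sum_def summable_sums)
  then have "(\<lambda>i. F (Suc i)) sums (abel_sum x f - f 1)"
    using sums_Suc_iff[of F "abel_sum x f - f 1"] by (simp add: F_def)
  then have "(\<lambda>i. F (Suc i) / x - F i) sums ((abel_sum x f - f 1) / x - abel_sum x f)"
    by (intro sums_diff sums_divide F)
  also have "(\<lambda>i. F (Suc i) / x - F i) = (\<lambda>i. x ^ i * fdiff f (of_nat (Suc i)))"
    using \<open>x \<noteq> 0\<close> by (auto simp: F_def fdiff_def algebra_simps)
  finally have s: "(\<lambda>i. x ^ i * fdiff f (of_nat (Suc i))) sums
      ((abel_sum x f - f 1) / x - abel_sum x f)" .
  then show "summable (\<lambda>i. x ^ i * fdiff f (of_nat (Suc i)))"
    by (rule sums_summable)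
  have "abel_sum x (fdiff f) = (abel_sum x f - f 1) / x - abel_sum x f"
    using s unfolding abel_sum_def[of x "fdiff f"] by (rule sums_unique[symmetric])
  then have "(1 - x) * abel_sum x f = f 1 + x * abel_sum x (fdiff f)"
    using assms(2) by (simp add: field_simps)
  then have "abel_sum x f = (f 1 + x * abel_sum x (fdiff f)) / (1 - x)"
    using assms(3) by (metis nonzero_mult_div_cancel_left right_minus_eq)
  then show "abel_sum x f = f 1 / (1 - x) + x / (1 - x) * abel_sum x (fdiff f)"
    by (simp add: add_divide_distrib)
qed

lemma abel_sum_eq_euler_sum:
  assumes "summable (\<lambda>i. x ^ i * f (of_nat (Suc i)))" "x \<noteq> 0" "x \<noteq> 1"
  shows "abel_sum x f = euler_sum n f x"
proof -
  have "summable (\<lambda>i. x ^ i * (fdiff ^^ n) f (of_nat (Suc i))) \<and> abel_sum x f = euler_sum n f x"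
  proof (induction n)
    case 0
    then show ?case using assms(1) by (simp add: euler_sum_def)
  next
    case (Suc n)
    note * = abel_sum_fdiff[OF Suc.IH[THEN conjunct1] assms(2,3)]
    have "(x / (1 - x)) ^ n * (a / (1 - x) + x / (1 - x) * b)
        = x ^ n * a / (1 - x) ^ Suc n + (x / (1 - x)) ^ Suc n * b" for a b
      by (simp add: power_divide distrib_left mult.commute)
    then show ?case using Suc.IH *
      by (simp add: euler_sum_def del: power_Suc)
  qed
  then show ?thesis ..
qed

text \<open>The condition \<open>norm (1 - x) \<ge> 1\<close> is met by x = -r with r in (0,1),
  which makes the bound uniform in r.\<close>

lemma norm_euler_sum_le:
  assumes "norm x \<le> 1" "norm (1 - x) \<ge> 1"
    and "summable (\<lambda>i. norm ((fdiff ^^ n) f (of_nat (Suc i))))"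
  shows "norm (euler_sum n f x)
    \<le> (\<Sum>j<n. norm ((fdiff ^^ j) f 1)) + (\<Sum>i. norm ((fdiff ^^ n) f (of_nat (Suc i))))"
proof -
  have le: "norm (x ^ j * w) \<le> norm w" for j w
    using assms(1) by (simp add: norm_mult norm_power mult_left_le_one_le power_le_one)
  have s: "summable (\<lambda>i. norm (x ^ i * (fdiff ^^ n) f (of_nat (Suc i))))"
    by (rule summable_comparison_test'[OF assms(3)]) (use le in auto)
  have t1: "norm (x ^ j * (fdiff ^^ j) f 1 / (1 - x) ^ Suc j) \<le> norm ((fdiff ^^ j) f 1)" for j
  proof -
    have "norm (x ^ j * (fdiff ^^ j) f 1 / (1 - x) ^ Suc j)
        \<le> norm (x ^ j * (fdiff ^^ j) f 1) / 1"
      unfolding norm_divide norm_power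
      by (intro divide_left_mono one_le_power assms) (use assms in \<open>auto intro!: mult_pos_pos zero_less_power\<close>)
    then show ?thesis using le[of j "(fdiff ^^ j) f 1"] by simp
  qed
  have "norm (x / (1 - x)) \<le> 1"
    using assms(1,2) unfolding norm_divide by (subst divide_le_eq_1_pos) auto
  then have "norm ((x / (1 - x)) ^ n) \<le> 1"
    unfolding norm_power by (intro power_le_one) auto
  then have "norm ((x / (1 - x)) ^ n * abel_sum x ((fdiff ^^ n) f)) \<le> norm (abel_sum x ((fdiff ^^ n) f))"
    by (simp add: norm_mult mult_left_le_one_le)
  also have "\<dots> \<le> (\<Sum>i. norm (x ^ i * (fdiff ^^ n) f (of_nat (Suc i))))"
    unfolding abel_sum_def by (rule summable_norm[OF s])
  also have "\<dots> \<le> (\<Sum>i. norm ((fdiff ^^ n) f (of_nat (Suc i))))"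
    by (rule suminf_le[OF _ s assms(3)]) (rule le)
  finally show ?thesis
    unfolding euler_sum_def
    by (intro norm_triangle_mono sum_norm_le t1)
qed

text \<open>The norms of the \<open>n\<close>-th differences dominate the remainder series for all r
  in (0,1), so Tannery's theorem gives the limit termwise.\<close>

lemma tendsto_euler_sum:
  assumes "norm x \<le> 1" "x \<noteq> 1"
    and "summable (\<lambda>i. norm ((fdiff ^^ n) f (of_nat (Suc i))))"
  shows "((\<lambda>r. euler_sum n f (of_real r * x)) \<longlongrightarrow> euler_sum n f x) (at_left 1)"
proof -
  have r01: "eventually (\<lambda>r. r \<in> {0<..<(1::real)}) (at_left 1)"
    by (rule eventually_at_left_real) simp
  have lim: "((\<lambda>r. of_real r * x) \<longlongrightarrow> x) (at_left 1)"
    by (rule tendsto_eq_intros refl | simp)+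
  have "((\<lambda>r. \<Sum>i. (of_real r * x) ^ i * (fdiff ^^ n) f (of_nat (Suc i)))
       \<longlongrightarrow> (\<Sum>i. x ^ i * (fdiff ^^ n) f (of_nat (Suc i)))) (at_left 1)"
  proof (rule tannerys_theorem[THEN conjunct2, THEN conjunct2, OF _ _ assms(3)])
    show "((\<lambda>r. (of_real r * x) ^ k * (fdiff ^^ n) f (of_nat (Suc k)))
       \<longlongrightarrow> x ^ k * (fdiff ^^ n) f (of_nat (Suc k))) (at_left 1)" for k
      by (intro tendsto_intros lim)
    have "norm ((of_real r * x) ^ k * (fdiff ^^ n) f (of_nat (Suc k)))
          \<le> norm ((fdiff ^^ n) f (of_nat (Suc k)))" if "r \<in> {0<..<1}" for r k
      using that assms(1) unfolding norm_mult norm_power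
      by (intro mult_left_le_one_le power_le_one mult_le_one) auto
    then show "\<forall>\<^sub>F (k, r) in at_top \<times>\<^sub>F at_left 1.
        norm ((of_real r * x) ^ k * (fdiff ^^ n) f (of_nat (Suc k)))
          \<le> norm ((fdiff ^^ n) f (of_nat (Suc k)))"
      by (intro eventually_mono[OF eventually_prodI[OF always_eventually[of "\<lambda>_. True"] r01]]) auto
  qed auto
  then show ?thesis
    using assms(2) unfolding euler_sum_def abel_sum_def
    by (intro tendsto_intros lim) auto
qed

lemma tendsto_abel_sum:
  assumes "norm x \<le> 1" "x \<noteq> 0" "x \<noteq> 1"
    and "\<And>r. r \<in> {0<..<1} \<Longrightarrow> summable (\<lambda>i. (of_real r * x) ^ i * f (of_nat (Suc i)))"
    and "summable (\<lambda>i. norm ((fdiff ^^ n) f (of_nat (Suc i))))"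
  shows "((\<lambda>r. abel_sum (of_real r * x) f) \<longlongrightarrow> euler_sum n f x) (at_left 1)"
proof (rule Lim_transform_eventually[OF tendsto_euler_sum[OF assms(1,3,5)]])
  have "eventually (\<lambda>r. r \<in> {0<..<(1::real)}) (at_left 1)"
    by (rule eventually_at_left_real) simp
  then show "\<forall>\<^sub>F r in at_left 1. euler_sum n f (of_real r * x) = abel_sum (of_real r * x) f"
  proof eventually_elim
    case (elim r)
    have "r * norm x \<le> r" using elim assms(1) by (intro mult_left_le) auto
    also have "r < 1" using elim by simp
    finally have "norm (of_real r * x) < 1" using elim by (simp add: norm_mult)
    then have "of_real r * x \<noteq> 1" by force
    then show ?case
      using abel_sum_eq_euler_sum[OF assms(4)[OF elim]] elim assms(2) by simp
  qed
qed

section \<open>Polylogarithms on the unit circle\<close>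

lemma power_le_fact_exp:
  fixes y :: real
  assumes "y \<ge> 0"
  shows "y ^ p \<le> fact p * exp y"
proof -
  have "y ^ p /\<^sub>R fact p \<le> (\<Sum>n. y ^ n /\<^sub>R fact n)"
    using sum_le_suminf[OF summable_exp_generic, of "{p}" y] assms by simp
  then show ?thesis by (simp add: exp_def field_simps)
qed

lemma summable_power_times_polynomial:
  fixes r :: real
  assumes "0 < r" "r < 1"
  shows "summable (\<lambda>i. r ^ i * real (Suc i) ^ p)"
proof -
  \<comment> \<open>With r = exp(-2e), half of the exponential decay absorbs the polynomial and the
    other half remains as a convergent geometric series.\<close>
  define e where "e = - ln r / 2"
  have e: "e > 0" using assms by (simp add: e_def)
  have re: "r * exp e = exp (-e)"
  proof -
    have "exp (- 2 * e) = r" using assms by (simp add: e_def)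
    then have "r * exp e = exp (- 2 * e) * exp e" by simp
    then show ?thesis by (simp flip: exp_add)
  qed
  show ?thesis
  proof (rule summable_comparison_test')
    show "summable (\<lambda>i. fact p * exp e / e ^ p * exp (-e) ^ i)"
      using e by (intro summable_mult summable_geometric) auto
    fix i :: nat
    have "(e * real (Suc i)) ^ p \<le> fact p * exp (e * real (Suc i))"
      using e by (intro power_le_fact_exp) auto
    also have "exp (e * real (Suc i)) = exp e * exp e ^ i"
      by (simp add: exp_of_nat_mult[symmetric] exp_add[symmetric] algebra_simps)
    finally have "real (Suc i) ^ p \<le> fact p * (exp e * exp e ^ i) / e ^ p"
      using e unfolding power_mult_distrib by (simp add: pos_le_divide_eq mult.commute del: of_nat_Suc)
    then have "r ^ i * real (Suc i) ^ p \<le> r ^ i * (fact p * (exp e * exp e ^ i) / e ^ p)"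
      using assms by (intro mult_left_mono) auto
    also have "\<dots> = fact p * exp e / e ^ p * (r * exp e) ^ i"
      by (simp add: power_mult_distrib)
    finally show "norm (r ^ i * real (Suc i) ^ p) \<le> fact p * exp e / e ^ p * exp (-e) ^ i"
      using assms by (simp add: re)
  qed
qed

text \<open>The modulus is at most exp(|s| |Ln z|), and |Ln z| exceeds ln |z| by at most a constant
  on the sector, so the growth is polynomial, uniformly for s in the disc of radius
  \<open>p\<close>.\<close>

lemma norm_powr_le_sector:
  assumes "z \<in> sector" "norm s \<le> real p"
  shows "norm (z powr (-s)) \<le> exp (real p * (pi + 1)) * norm z ^ p"
proof -
  have z: "norm z \<ge> 3 / 4" "norm z > 0" "z \<noteq> 0"
    using sectorD[OF assms(1)] by auto
  \<comment> \<open>The modulus of z may fall below 1, where its logarithm is negative; the summand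
    1 in \<open>pi + 1\<close> pays for this.\<close>
  have "ln (3 / 4 :: real) \<ge> - 1 / 3"
    using ln_le_minus_one[of "4 / 3"] ln_div[of 3 "4::real"] ln_div[of 4 "3::real"] by simp
  moreover have "ln (3 / 4) \<le> ln (norm z)" using z by (subst ln_le_cancel_iff) auto
  ultimately have "\<bar>ln (norm z)\<bar> \<le> ln (norm z) + 1" by linarith
  moreover have "\<bar>Im (Ln z)\<bar> \<le> pi"
    using Im_Ln_le_pi[OF z(3)] mpi_less_Im_Ln[OF z(3)] by linarith
  ultimately have L: "norm (Ln z) \<le> ln (norm z) + (pi + 1)"
    using cmod_le[of "Ln z"] z by simp
  have "norm (z powr (-s)) = exp (Re (- s * Ln z))"
    using z by (simp add: powr_def)
  also have "Re (- s * Ln z) \<le> norm s * norm (Ln z)"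
    using complex_Re_le_cmod[of "- s * Ln z"] by (simp add: norm_mult)
  also have "\<dots> \<le> real p * (ln (norm z) + (pi + 1))"
    using assms(2) L by (intro mult_mono) auto
  also have "exp (real p * (ln (norm z) + (pi + 1))) = exp (real p * (pi + 1)) * norm z ^ p"
    using z by (simp add: exp_add distrib_left exp_of_nat_mult)
  finally show ?thesis by simp
qed

text \<open>The modulus of 1 - 1/z is at most exp(-1/(6|z|)), so the power decays like
  exp(-n/(6|z|)), and an exponential beats every power. Decay of order \<open>p\<close> in
  \<open>n\<close> is thus bought with growth of order \<open>p\<close> in z.\<close>

lemma norm_one_minus_inverse_power_le_sector:
  assumes "z \<in> sector"
  shows "norm ((1 - 1 / z) ^ n) \<le> exp 1 * fact p * 6 ^ p / real (Suc n) ^ p * norm z ^ p"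
proof -
  have z: "norm z \<ge> 3 / 4" "norm z > 0" "z \<noteq> 0"
    using sectorD[OF assms(1)] by auto
  \<comment> \<open>From Re z >= 3/4 follows 2 Re z - 1 >= (2/3) Re z, and Re z >= |z|/2 in the
    sector.\<close>
  have Re: "2 * Re z - 1 \<ge> norm z / 3"
    using assms sectorD[OF assms] by (auto simp: sector_def)
  have "1 - 1 / z = (z - 1) / z" using z by (simp add: field_simps)
  then have "norm (1 - 1 / z) ^ 2 = norm (z - 1) ^ 2 / norm z ^ 2"
    by (simp add: norm_divide power_divide)
  also have "norm (z - 1) ^ 2 = norm z ^ 2 - (2 * Re z - 1)"
    by (simp add: cmod_power2) (simp add: power2_eq_square algebra_simps)
  also have "(norm z ^ 2 - (2 * Re z - 1)) / norm z ^ 2 \<le> (norm z ^ 2 - norm z / 3) / norm z ^ 2"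
    using Re by (intro divide_right_mono) auto
  also have "\<dots> = 1 - 1 / (3 * norm z)"
    using z by (simp add: field_simps power2_eq_square)
  also have "\<dots> \<le> exp (- 1 / (3 * norm z))"
    using exp_ge_add_one_self[of "- 1 / (3 * norm z)"] by simp
  also have "\<dots> = exp (- 1 / (6 * norm z)) ^ 2"
    by (simp flip: exp_of_nat_mult)
  finally have "norm (1 - 1 / z) \<le> exp (- 1 / (6 * norm z))"
    by (rule power2_le_imp_le) simp
  then have "norm ((1 - 1 / z) ^ n) \<le> exp (- 1 / (6 * norm z)) ^ n"
    unfolding norm_power by (intro power_mono) auto
  \<comment> \<open>Passing from n to n + 1 keeps the later denominator nonzero at n = 0; it costs a
    factor of at most e because 6|z| >= 1.\<close>
  also have "\<dots> = exp (1 / (6 * norm z)) * exp (- (real (Suc n) / (6 * norm z)))"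
    by (simp add: exp_of_nat_mult[symmetric] exp_add[symmetric] add_divide_distrib)
  also have "\<dots> \<le> exp 1 * (fact p / (real (Suc n) / (6 * norm z)) ^ p)"
  proof (intro mult_mono)
    have *: "exp (- y) \<le> c / a" if "a \<le> c * exp y" "a > 0" for a c y :: real
      using that by (simp add: exp_minus field_simps)
    have "(real (Suc n) / (6 * norm z)) ^ p \<le> fact p * exp (real (Suc n) / (6 * norm z))"
      by (intro power_le_fact_exp) auto
    moreover have "(real (Suc n) / (6 * norm z)) ^ p > 0" using z by simp
    ultimately show "exp (- (real (Suc n) / (6 * norm z))) \<le> fact p / (real (Suc n) / (6 * norm z)) ^ p"
      by (rule *)
  qed (use z in auto)
  also have "\<dots> = exp 1 * fact p * 6 ^ p / real (Suc n) ^ p * norm z ^ p"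
    using z by (simp add: power_divide power_mult_distrib field_simps)
  finally show ?thesis .
qed

section \<open>Summability of differences of high order\<close>

definition fdiff_bound :: "nat \<Rightarrow> nat \<Rightarrow> real" where
  "fdiff_bound n p = fact n * 4 ^ n * (2 * (real n + 1)) ^ p"

text \<open>The bound depends on \<open>f\<close> only through \<open>B\<close> and
  \<open>p\<close>. This provides the uniformity in s for the polylogarithm and in n for the Newton
  coefficients.\<close>

lemma norm_fdiff_le_inverse_square:
  assumes "f holomorphic_on {z. Re z > 0}"
    and "\<And>z. z \<in> sector \<Longrightarrow> norm (f z) \<le> B * norm z ^ p" and "B \<ge> 0"
  shows "norm ((fdiff ^^ (p + 2)) f (of_nat (Suc i)))
       \<le> fdiff_bound (p + 2) p * B * inverse (real (Suc i) ^ 2)"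
proof -
  define m where "m = real (Suc i)"
  have "m > 0" by (simp add: m_def)
  then have "c * m ^ p / m ^ (p + 2) = c * inverse (m ^ 2)" for c
    by (simp add: power_add field_simps power2_eq_square)
  then show ?thesis
    using norm_fdiff_le_power[OF assms, of "p + 2" i]
    unfolding fdiff_bound_def m_def by simp
qed

lemma summable_inverse_square_Suc: "summable (\<lambda>i. inverse (real (Suc i) ^ 2))"
  using inverse_power_summable[of 2, where 'a = real] by (subst summable_Suc_iff) auto

lemma summable_fdiff:
  assumes "f holomorphic_on {z. Re z > 0}"
    and "\<And>z. z \<in> sector \<Longrightarrow> norm (f z) \<le> B * norm z ^ p" and "B \<ge> 0"
  shows "summable (\<lambda>i. norm ((fdiff ^^ (p + 2)) f (of_nat (Suc i))))"
  by (rule summable_comparison_test'[OF summable_mult[OF summable_inverse_square_Suc]])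
     (use norm_fdiff_le_inverse_square[OF assms] in simp)

lemma of_nat_Suc_in_sector: "of_nat (Suc i) \<in> sector"
  by (simp add: sector_def)

lemma summable_abel_sum:
  fixes f :: "complex \<Rightarrow> complex" and x :: complex
  assumes "\<And>z. z \<in> sector \<Longrightarrow> norm (f z) \<le> B * norm z ^ p" "norm x < 1" "x \<noteq> 0"
  shows "summable (\<lambda>i. norm (x ^ i * f (of_nat (Suc i))))"
proof (rule summable_comparison_test')
  show "summable (\<lambda>i. B * (norm x ^ i * real (Suc i) ^ p))"
    using assms by (intro summable_mult summable_power_times_polynomial) auto
  fix i
  have "norm (f (of_nat (Suc i))) \<le> B * real (Suc i) ^ p"
    using assms(1)[OF of_nat_Suc_in_sector[of i]] by (simp only: norm_of_nat)
  then have "norm x ^ i * norm (f (of_nat (Suc i))) \<le> norm x ^ i * (B * real (Suc i) ^ p)"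
    by (intro mult_left_mono) auto
  then show "norm (norm (x ^ i * f (of_nat (Suc i)))) \<le> B * (norm x ^ i * real (Suc i) ^ p)"
    by (simp add: norm_mult norm_power mult.left_commute del: of_nat_Suc)
qed

section \<open>The polylogarithm as a radial limit, entire in s\<close>

lemma holomorphic_powr_minus: "(\<lambda>z. z powr (-s)) holomorphic_on {z. Re z > 0}"
  by (intro holomorphic_intros) (auto simp: complex_nonpos_Reals_iff)

text \<open>This is \<open>Li\<^sub>s(x) / x\<close>, since \<^const>\<open>abel_sum\<close> attaches \<open>x\<^bsup>m-1\<^esup>\<close> to the term of index \<open>m\<close>.\<close>

definition polylog :: "complex \<Rightarrow> complex \<Rightarrow> complex" where
  "polylog x s = Lim (at_left 1) (\<lambda>r. abel_sum (of_real r * x) (\<lambda>z. z powr (-s)))"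

lemma tendsto_polylog_euler_sum:
  assumes x: "norm x \<le> 1" "x \<noteq> 0" "x \<noteq> 1"
    and "summable (\<lambda>i. norm ((fdiff ^^ n) (\<lambda>z. z powr (-s)) (of_nat (Suc i))))"
  shows "((\<lambda>r. abel_sum (of_real r * x) (\<lambda>z. z powr (-s)))
       \<longlongrightarrow> euler_sum n (\<lambda>z. z powr (-s)) x) (at_left 1)"
proof (rule tendsto_abel_sum[OF x _ assms(4)])
  fix r :: real assume r: "r \<in> {0<..<1}"
  then have "r * norm x \<le> r" using x by (intro mult_left_le) auto
  also have "r < 1" using r by simp
  finally have "norm (of_real r * x) < 1" using r by (simp add: norm_mult)
  then show "summable (\<lambda>i. (of_real r * x) ^ i * of_nat (Suc i) powr (-s))"
    using x r
    by (intro summable_norm_cancel[OF summable_abel_sum[OF norm_powr_le_sector[where p = "nat \<lceil>norm s\<rceil>"]]])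
       (auto simp: of_nat_ceiling)
qed

text \<open>The left side does not involve \<open>n\<close>, so \<open>n\<close> can be adapted to
  the purpose: 0 recovers the Dirichlet series for Re s > 1, while \<open>p + 2\<close> reaches the
  whole disc of radius \<open>p\<close>.\<close>

lemma polylog_eq_euler_sum:
  assumes x: "norm x \<le> 1" "x \<noteq> 0" "x \<noteq> 1"
    and "summable (\<lambda>i. norm ((fdiff ^^ n) (\<lambda>z. z powr (-s)) (of_nat (Suc i))))"
  shows "polylog x s = euler_sum n (\<lambda>z. z powr (-s)) x"
  unfolding polylog_def by (rule tendsto_Lim[OF _ tendsto_polylog_euler_sum[OF assms]]) simp

lemma summable_fdiff_powr:
  assumes "norm s \<le> real p"
  shows "summable (\<lambda>i. norm ((fdiff ^^ (p + 2)) (\<lambda>z. z powr (-s)) (of_nat (Suc i))))"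
  by (rule summable_fdiff[OF holomorphic_powr_minus norm_powr_le_sector[OF _ assms]]) auto

text \<open>Existence of the limit behind the \<open>Lim\<close> in \<open>polylog\<close>, obtained
  by taking enough differences for the given s.\<close>

lemma tendsto_polylog:
  assumes x: "norm x \<le> 1" "x \<noteq> 0" "x \<noteq> 1"
  shows "((\<lambda>r. abel_sum (of_real r * x) (\<lambda>z. z powr (-s))) \<longlongrightarrow> polylog x s) (at_left 1)"
proof -
  have "norm s \<le> real (nat \<lceil>norm s\<rceil>)" by (rule of_nat_ceiling)
  from summable_fdiff_powr[OF this] show ?thesis
    using tendsto_polylog_euler_sum[OF x] polylog_eq_euler_sum[OF x] by metis
qed

lemma holomorphic_fdiff_powr:
  assumes "Re w > 0"
  shows "(\<lambda>s. (fdiff ^^ n) (\<lambda>z. z powr (-s)) w) holomorphic_on A"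
  using assms
proof (induction n arbitrary: w)
  case 0
  then show ?case by (auto intro!: holomorphic_intros)
next
  case (Suc n)
  then show ?case
    unfolding fdiff_funpow_Suc by (intro holomorphic_intros Suc.IH) auto
qed

text \<open>On the disc of radius \<open>p\<close> the Euler sum with \<open>p + 2\<close>
  differences converges uniformly by the M-test; these discs exhaust the plane.\<close>

lemma holomorphic_polylog:
  assumes x: "norm x \<le> 1" "x \<noteq> 0" "x \<noteq> 1"
  shows "polylog x holomorphic_on UNIV"
proof -
  have "polylog x holomorphic_on ball 0 (real p)" for p
  proof -
    let ?f = "\<lambda>s z. z powr (-s) :: complex"
    define C where "C = fdiff_bound (p + 2) p * exp (real p * (pi + 1))"
    have "uniform_limit (ball 0 (real p))
            (\<lambda>n s. \<Sum>i<n. x ^ i * (fdiff ^^ (p + 2)) (?f s) (of_nat (Suc i)))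
            (\<lambda>s. \<Sum>i. x ^ i * (fdiff ^^ (p + 2)) (?f s) (of_nat (Suc i))) sequentially"
    proof (rule Weierstrass_m_test)
      show "summable (\<lambda>i. C * inverse (real (Suc i) ^ 2))"
        by (intro summable_mult summable_inverse_square_Suc)
      fix i and s :: complex assume "s \<in> ball 0 (real p)"
      then have s: "norm s \<le> real p" by simp
      have "norm (x ^ i * (fdiff ^^ (p + 2)) (?f s) (of_nat (Suc i)))
          \<le> norm ((fdiff ^^ (p + 2)) (?f s) (of_nat (Suc i)))"
        using x unfolding norm_mult norm_power by (intro mult_left_le_one_le power_le_one) auto
      also have "\<dots> \<le> C * inverse (real (Suc i) ^ 2)"
        unfolding C_def
        by (rule norm_fdiff_le_inverse_square[OF holomorphic_powr_minus norm_powr_le_sector[OF _ s]]) auto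
      finally show "norm (x ^ i * (fdiff ^^ (p + 2)) (?f s) (of_nat (Suc i)))
          \<le> C * inverse (real (Suc i) ^ 2)" .
    qed
    note lim = this
    have "(\<lambda>s. \<Sum>i. x ^ i * (fdiff ^^ (p + 2)) (?f s) (of_nat (Suc i))) holomorphic_on ball 0 (real p)"
    proof (rule holomorphic_uniform_sequence[OF open_ball])
      show "(\<lambda>s. \<Sum>i<n. x ^ i * (fdiff ^^ (p + 2)) (?f s) (of_nat (Suc i))) holomorphic_on ball 0 (real p)" for n
        by (intro holomorphic_intros holomorphic_fdiff_powr) simp
      fix s :: complex assume "s \<in> ball 0 (real p)"
      then obtain d where "d > 0" "cball s d \<subseteq> ball 0 (real p)"
        using open_contains_cball open_ball by blast
      then show "\<exists>d>0. cball s d \<subseteq> ball 0 (real p) \<and> uniform_limit (cball s d)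
            (\<lambda>n s. \<Sum>i<n. x ^ i * (fdiff ^^ (p + 2)) (?f s) (of_nat (Suc i)))
            (\<lambda>s. \<Sum>i. x ^ i * (fdiff ^^ (p + 2)) (?f s) (of_nat (Suc i))) sequentially"
        using uniform_limit_on_subset[OF lim] by blast
    qed
    then have "(\<lambda>s. euler_sum (p + 2) (?f s) x) holomorphic_on ball 0 (real p)"
      using x unfolding euler_sum_def abel_sum_def
      by (intro holomorphic_intros holomorphic_fdiff_powr) auto
    then show ?thesis
    proof (rule holomorphic_transform)
      fix s :: complex assume "s \<in> ball 0 (real p)"
      then have "norm s \<le> real p" by simp
      then show "euler_sum (p + 2) (?f s) x = polylog x s"
        by (rule polylog_eq_euler_sum[OF x summable_fdiff_powr, symmetric])
    qed
  qed
  then have "polylog x holomorphic_on (\<Union>p. ball 0 (real p))"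
    by (intro holomorphic_on_UN_open) auto
  also have "(\<Union>p. ball (0::complex) (real p)) = UNIV"
    using reals_Archimedean2 by (auto simp: set_eq_iff)
  finally show ?thesis .
qed

lemma summable_Suc_powr:
  assumes "Re s > 1"
  shows "summable (\<lambda>i. norm (of_nat (Suc i) powr (-s) :: complex))"
proof -
  have "summable (\<lambda>i. real (Suc i) powr (- Re s))"
    using summable_real_powr_iff[of "- Re s"] assms by (subst summable_Suc_iff) simp
  then show ?thesis
    by (simp add: norm_powr_real_powr del: of_nat_Suc)
qed

lemma polylog_sums:
  assumes x: "norm x \<le> 1" "x \<noteq> 0" "x \<noteq> 1" and s: "Re s > 1"
  shows "(\<lambda>i. x ^ i * of_nat (Suc i) powr (-s)) sums polylog x s"
proof -
  \<comment> \<open>No summation by parts (\<open>n = 0\<close>): the series already converges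
    absolutely.\<close>
  have "polylog x s = abel_sum x (\<lambda>z. z powr (-s))"
    using polylog_eq_euler_sum[OF x, of 0 s] summable_Suc_powr[OF s] by (simp add: euler_sum_def)
  moreover have "summable (\<lambda>i. x ^ i * of_nat (Suc i) powr (-s))"
  proof (rule summable_comparison_test'[OF summable_Suc_powr[OF s]])
    show "norm (x ^ i * of_nat (Suc i) powr (-s)) \<le> norm (of_nat (Suc i) powr (-s) :: complex)" for i
      using x unfolding norm_mult norm_power by (intro mult_left_le_one_le power_le_one) auto
  qed
  ultimately show ?thesis by (simp add: abel_sum_def summable_sums)
qed

section \<open>Continuation of the zeta function\<close>

lemma sum_roots_of_unity_power:
  assumes "q > 0"
  defines "\<omega> \<equiv> exp (2 * of_real pi * \<i> / of_nat q :: complex)"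
  shows "(\<Sum>j<q. (\<omega> ^ j) ^ m) = (if q dvd m then of_nat q else 0)"
proof -
  have pow: "\<omega> ^ m = exp (2 * of_real pi * \<i> * of_nat m / of_nat q)" for m
    by (simp add: \<omega>_def exp_of_nat_mult[symmetric] mult_ac)
  have one: "\<omega> ^ m = 1 \<longleftrightarrow> q dvd m"
    unfolding pow using assms(1) by (intro complex_root_unity_eq_1) simp
  have sum: "(\<Sum>j<q. (\<omega> ^ j) ^ m) = (\<Sum>j<q. (\<omega> ^ m) ^ j)"
    by (simp add: power_mult[symmetric] mult.commute)
  show ?thesis
  proof (cases "q dvd m")
    case True
    then show ?thesis using one by (simp add: sum)
  next
    case False
    have "(\<omega> ^ m) ^ q = (\<omega> ^ q) ^ m" by (simp add: power_mult[symmetric] mult.commute)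
    also have "\<dots> = 1" using assms(1) by (simp add: pow)
    finally show ?thesis using False one by (simp add: sum geometric_sum)
  qed
qed

text \<open>The entire function \<open>(1 - q\<^bsup>1-s\<^esup>) \<zeta>(s)\<close>, decomposed into polylogarithms at the nontrivial
  \<open>q\<close>-th roots of unity.\<close>

definition eta :: "nat \<Rightarrow> complex \<Rightarrow> complex" where
  "eta q s = - (\<Sum>j=1..<q. exp (2 * of_real pi * \<i> / of_nat q) ^ j *
                polylog (exp (2 * of_real pi * \<i> / of_nat q) ^ j) s)"

lemma root_of_unity_power_props:
  assumes "0 < j" "j < q"
  shows "norm (exp (2 * of_real pi * \<i> / of_nat q :: complex) ^ j) \<le> 1"
    "exp (2 * of_real pi * \<i> / of_nat q :: complex) ^ j \<noteq> 0"
    "exp (2 * of_real pi * \<i> / of_nat q :: complex) ^ j \<noteq> 1"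
proof -
  have "exp (2 * of_real pi * \<i> / of_nat q :: complex) ^ j = exp (2 * of_real pi * \<i> * of_nat j / of_nat q)"
    by (simp add: exp_of_nat_mult[symmetric] mult_ac)
  also have "\<dots> \<noteq> 1"
    using assms complex_root_unity_eq_1[of q j] by (auto dest: dvd_imp_le)
  finally show "exp (2 * of_real pi * \<i> / of_nat q :: complex) ^ j \<noteq> 1" .
qed (simp_all add: norm_power)

lemma holomorphic_eta: "eta q holomorphic_on A"
proof -
  have "(\<lambda>s. polylog (exp (2 * of_real pi * \<i> / of_nat q) ^ j) s) holomorphic_on A"
    if "j \<in> {1..<q}" for j
    using holomorphic_on_subset[OF holomorphic_polylog[OF root_of_unity_power_props[of j q]], of A] that
    by simp
  then show ?thesis
    unfolding eta_def[abs_def] by (intro holomorphic_intros)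
qed

lemma eta_two: "eta 2 s = polylog (-1) s"
proof -
  have "exp (2 * complex_of_real pi * \<i> / of_nat 2) = -1"
    using exp_pi_i by simp
  moreover have "{1..<2} = {1 :: nat}" by auto
  ultimately show ?thesis unfolding eta_def by simp
qed

definition zeta_series :: "complex \<Rightarrow> complex" where
  "zeta_series s = (\<Sum>i. of_nat (Suc i) powr (-s))"

lemma zeta_series_sums:
  assumes "Re s > 1"
  shows "(\<lambda>i. of_nat (Suc i) powr (-s)) sums zeta_series s"
  unfolding zeta_series_def
  using summable_norm_cancel[OF summable_Suc_powr[OF assms]] by (rule summable_sums)

text \<open>Summing over the nontrivial roots of unity gives the term of index m the coefficient 1 -
  q if q divides m, and 1 otherwise; the multiples of q contribute q^(1-s) times the full
  series.\<close>

lemma eta_eq_zeta_series: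
  assumes "q > 0" "Re s > 1"
  shows "eta q s = (1 - of_nat q powr (1 - s)) * zeta_series s"
proof -
  define \<omega> where "\<omega> = exp (2 * of_real pi * \<i> / of_nat q :: complex)"
  let ?c = "\<lambda>i. if q dvd Suc i then of_nat q else (0 :: complex)"
  \<comment> \<open>The extra factor \<open>\<omega> ^ j\<close> in \<open>eta\<close> turns the
    exponent m - 1 of the polylogarithm into m.\<close>
  have "(\<lambda>i. - (\<Sum>j=1..<q. \<omega> ^ j * ((\<omega> ^ j) ^ i * of_nat (Suc i) powr (-s)))) sums eta q s"
    unfolding eta_def \<omega>_def
    by (intro sums_minus sums_sum sums_mult polylog_sums root_of_unity_power_props assms) auto
  also have "(\<lambda>i. - (\<Sum>j=1..<q. \<omega> ^ j * ((\<omega> ^ j) ^ i * of_nat (Suc i) powr (-s))))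
      = (\<lambda>i. (1 - ?c i) * of_nat (Suc i) powr (-s))"
  proof
    fix i
    have "{..<q} = insert 0 {1..<q}" using assms(1) by auto
    then have "(\<Sum>j<q. (\<omega> ^ j) ^ Suc i) = 1 + (\<Sum>j=1..<q. (\<omega> ^ j) ^ Suc i)"
      by simp
    moreover have "(\<Sum>j<q. (\<omega> ^ j) ^ Suc i) = ?c i"
      using sum_roots_of_unity_power[OF assms(1), of "Suc i"] by (simp only: \<omega>_def)
    moreover have "- S = 1 - c" if "T = 1 + S" "T = c" for S T c :: complex
      using that by auto
    ultimately have "- (\<Sum>j=1..<q. (\<omega> ^ j) ^ Suc i) = 1 - ?c i"
      by blast
    moreover have "- (\<Sum>j=1..<q. \<omega> ^ j * ((\<omega> ^ j) ^ i * of_nat (Suc i) powr (-s)))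
        = - (\<Sum>j=1..<q. (\<omega> ^ j) ^ Suc i) * of_nat (Suc i) powr (-s)"
      by (simp only: power_Suc sum_distrib_right mult.assoc mult_minus_left)
    ultimately show "- (\<Sum>j=1..<q. \<omega> ^ j * ((\<omega> ^ j) ^ i * of_nat (Suc i) powr (-s)))
        = (1 - ?c i) * of_nat (Suc i) powr (-s)" by (simp only:)
  qed
  finally have 1: "(\<lambda>i. (1 - ?c i) * of_nat (Suc i) powr (-s)) sums eta q s" .
  \<comment> \<open>\<open>g k\<close> is the position of the multiple q(k+1) in a series whose term
    at position i belongs to i + 1.\<close>
  define g where "g k = q * Suc k - 1" for k
  have g: "Suc (g k) = q * Suc k" for k
    using assms(1) by (simp add: g_def)
  have "strict_mono g"
  proof (rule strict_monoI)
    fix k l :: nat assume "k < l"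
    then have "Suc (g k) < Suc (g l)" unfolding g using assms(1) by simp
    then show "g k < g l" by simp
  qed
  moreover have "?c n * of_nat (Suc n) powr (-s) = 0" if "n \<notin> range g" for n
  proof -
    have "\<not> q dvd Suc n"
    proof
      assume "q dvd Suc n"
      then obtain k where k: "Suc n = q * k" by (elim dvdE)
      then obtain l where "k = Suc l" by (cases k) auto
      then have "n = g l" using k g[of l] by simp
      then show False using that by simp
    qed
    then show ?thesis by simp
  qed
  ultimately have reindex: "(\<lambda>i. ?c i * of_nat (Suc i) powr (-s)) sums S
      \<longleftrightarrow> (\<lambda>k. ?c (g k) * of_nat (Suc (g k)) powr (-s)) sums S" for S
    by (rule sums_mono_reindex[symmetric])
  have "(\<lambda>k. of_nat q powr (1 - s) * of_nat (Suc k) powr (-s)) sums (of_nat q powr (1 - s) * zeta_series s)"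
    by (intro sums_mult zeta_series_sums assms)
  also have "(\<lambda>k. of_nat q powr (1 - s) * of_nat (Suc k) powr (-s))
      = (\<lambda>k. ?c (g k) * of_nat (Suc (g k)) powr (-s))"
  proof
    fix k
    have "(of_nat (q * Suc k) :: complex) powr (-s) = of_nat q powr (-s) * of_nat (Suc k) powr (-s)"
      by (simp only: of_nat_mult) (rule powr_times_real_left, auto)
    moreover have "(of_nat q :: complex) powr (1 - s) = of_nat q * of_nat q powr (-s)"
      using assms(1) powr_add[of "of_nat q :: complex" 1 "-s"] by simp
    ultimately show "of_nat q powr (1 - s) * of_nat (Suc k) powr (-s)
        = ?c (g k) * of_nat (Suc (g k)) powr (-s)"
      unfolding g by (simp only: mult.assoc dvd_triv_left if_True)
  qed
  finally have "(\<lambda>i. ?c i * of_nat (Suc i) powr (-s)) sums (of_nat q powr (1 - s) * zeta_series s)"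
    unfolding reindex .
  from sums_diff[OF zeta_series_sums[OF assms(2)] this]
  have "(\<lambda>i. (1 - ?c i) * of_nat (Suc i) powr (-s)) sums
      (zeta_series s - of_nat q powr (1 - s) * zeta_series s)"
    by (simp only: left_diff_distrib mult_1_left)
  then show ?thesis
    using sums_unique2[OF 1] by (simp add: left_diff_distrib)
qed

section \<open>Gluing the continuation from the bases 2 and 3\<close>

lemma powr_two_three_eq_1:
  fixes w :: complex
  assumes "2 powr w = 1" "3 powr w = 1"
  shows "w = 0"
proof -
  have "exp (w * of_real (ln 2)) = 1" "exp (w * of_real (ln 3)) = 1"
    using assms Ln_of_real[of 2] Ln_of_real[of 3] by (simp_all add: powr_def)
  then obtain k l :: int where Re: "Re w = 0"
    and k: "Im w * ln 2 = of_int (2 * k) * pi" and l: "Im w * ln 3 = of_int (2 * l) * pi"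
    unfolding exp_eq_1 by auto
  have "Im w = 0"
  proof (rule ccontr)
    assume ne: "Im w \<noteq> 0"
    then have "k \<noteq> 0" "l \<noteq> 0" using k l by auto
    have "Im w * (of_int l * ln 2) = of_int l * (Im w * ln 2)" by simp
    also have "\<dots> = of_int k * (Im w * ln 3)" unfolding k l by simp
    finally have "of_int l * ln 2 = of_int k * ln (3::real)" using ne by simp
    \<comment> \<open>Absolute values give natural exponents, and a positive power of 2 would equal
      a power of 3, contradicting parity.\<close>
    then have "\<bar>of_int l * ln (2::real)\<bar> = \<bar>of_int k * ln 3\<bar>" by simp
    then have "real (nat \<bar>l\<bar>) * ln 2 = real (nat \<bar>k\<bar>) * ln 3"
      by (simp add: abs_mult)
    then have "ln ((2::real) ^ nat \<bar>l\<bar>) = ln (3 ^ nat \<bar>k\<bar>)"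
      by (simp add: ln_realpow)
    then have "(2::real) ^ nat \<bar>l\<bar> = 3 ^ nat \<bar>k\<bar>" by simp
    then have "(2::nat) ^ nat \<bar>l\<bar> = 3 ^ nat \<bar>k\<bar>"
      by (metis of_nat_eq_iff of_nat_numeral of_nat_power)
    moreover have "even ((2::nat) ^ nat \<bar>l\<bar>)" using \<open>l \<noteq> 0\<close> by simp
    moreover have "odd ((3::nat) ^ nat \<bar>k\<bar>)" by simp
    ultimately show False by simp
  qed
  with Re show ?thesis by (simp add: complex_eq_iff)
qed

text \<open>For Re s > 1 both sides are the zeta series times both factors; both are entire, so the
  identity theorem applies.\<close>

lemma eta_cross_eq: "(1 - 3 powr (1 - s)) * eta 2 s = (1 - 2 powr (1 - s)) * eta 3 s"
proof (rule analytic_continuation_open[of "{s. Re s > 1}" UNIV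
      "\<lambda>s. (1 - 3 powr (1 - s)) * eta 2 s" "\<lambda>s. (1 - 2 powr (1 - s)) * eta 3 s"])
  show "{s :: complex. Re s > 1} \<noteq> {}" by (auto intro!: exI[of _ 2])
  fix z :: complex assume "z \<in> {s. Re s > 1}"
  then show "(1 - 3 powr (1 - z)) * eta 2 z = (1 - 2 powr (1 - z)) * eta 3 z"
    using eta_eq_zeta_series[of 2 z] eta_eq_zeta_series[of 3 z] by simp
qed (auto intro!: holomorphic_intros holomorphic_eta open_halfspace_Re_gt)

text \<open>Base 3 steps in at the zeros of 1 - 2^(1-s) other than 1; the value at 1 copies the
  convention in \<open>riemann_zeta\<close>.\<close>

definition zeta_continuation :: "complex \<Rightarrow> complex" where
  "zeta_continuation s =
     (if s = 1 then 0 else if 2 powr (1 - s) = 1 then eta 3 s / (1 - 3 powr (1 - s))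
      else eta 2 s / (1 - 2 powr (1 - s)))"

lemma zeta_continuation_eq_eta:
  assumes "s \<noteq> 1" "q \<in> {2, 3}" "of_nat q powr (1 - s) \<noteq> 1"
  shows "zeta_continuation s = eta q s / (1 - of_nat q powr (1 - s))"
proof (cases "2 powr (1 - s) = 1")
  case True
  then show ?thesis using assms by (auto simp: zeta_continuation_def)
next
  case False
  have "eta 2 s / (1 - 2 powr (1 - s)) = eta 3 s / (1 - 3 powr (1 - s))" if "3 powr (1 - s) \<noteq> 1"
    using that False eta_cross_eq[of s] by (subst frac_eq_eq) (auto simp: mult.commute)
  with False show ?thesis using assms by (auto simp: zeta_continuation_def)
qed

lemma holomorphic_of_nat_powr:
  assumes "q > 0"
  shows "(\<lambda>s. of_nat q powr (1 - s) :: complex) holomorphic_on A"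
proof -
  have "(\<lambda>s. of_nat q powr (1 - s) :: complex) = (\<lambda>s. exp ((1 - s) * Ln (of_nat q)))"
    using assms by (simp add: powr_def)
  then show ?thesis by (auto intro!: holomorphic_intros)
qed

text \<open>For each base the quotient is holomorphic on an open set, and by
  \<open>powr_two_three_eq_1\<close> the two sets cover the punctured plane.\<close>

lemma holomorphic_zeta_continuation: "zeta_continuation holomorphic_on (- {1})"
proof -
  have hol: "zeta_continuation holomorphic_on {s. s \<noteq> 1 \<and> of_nat q powr (1 - s) \<noteq> 1}"
    if "q \<in> {2, 3}" for q
  proof (rule holomorphic_transform)
    show "(\<lambda>s. eta q s / (1 - of_nat q powr (1 - s))) holomorphic_on
        {s. s \<noteq> 1 \<and> of_nat q powr (1 - s) \<noteq> 1}"
      using that by (intro holomorphic_intros holomorphic_eta holomorphic_of_nat_powr) auto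
  qed (use zeta_continuation_eq_eta that in auto)
  have open': "open {s :: complex. s \<noteq> 1 \<and> of_nat q powr (1 - s) \<noteq> 1}" if "q \<in> {2, 3}" for q
  proof -
    have "continuous_on UNIV (\<lambda>s :: complex. of_nat q powr (1 - s))"
      using that by (intro holomorphic_on_imp_continuous_on holomorphic_of_nat_powr) auto
    then have "open {s :: complex. of_nat q powr (1 - s) \<noteq> 1}"
      by (rule open_Collect_neq) (rule continuous_on_const)
    moreover have "open {s :: complex. s \<noteq> 1}"
      by (intro open_Collect_neq continuous_intros)
    ultimately show ?thesis by (rule open_Collect_conj[rotated])
  qed
  have "zeta_continuation holomorphic_on (\<Union>q\<in>{2, 3}. {s. s \<noteq> 1 \<and> of_nat q powr (1 - s) \<noteq> 1})"
    by (intro holomorphic_on_UN_open hol open')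
  also have "(\<Union>q\<in>{2, 3}. {s. s \<noteq> 1 \<and> of_nat q powr (1 - s) \<noteq> 1}) = - {1 :: complex}"
    using powr_two_three_eq_1[of "1 - s" for s] by auto
  finally show ?thesis .
qed

lemma zeta_continuation_sums:
  assumes "Re s > 1"
  shows "(\<lambda>n. 1 / of_nat (Suc n) powr s) sums zeta_continuation s"
proof -
  have s: "s \<noteq> 1" using assms by auto
  have "zeta_continuation s = zeta_series s"
  proof (cases "2 powr (1 - s) = 1")
    case True
    then have "3 powr (1 - s) \<noteq> 1" using s powr_two_three_eq_1[of "1 - s"] by auto
    then show ?thesis
      using zeta_continuation_eq_eta[OF s, of 3] eta_eq_zeta_series[of 3 s] assms by simp
  next
    case False
    then show ?thesis
      using zeta_continuation_eq_eta[OF s, of 2] eta_eq_zeta_series[of 2 s] assms by simp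
  qed
  then show ?thesis
    using zeta_series_sums[OF assms] by (simp add: powr_minus_divide)
qed

lemma analytic_continuation_punctured:
  assumes "f holomorphic_on (- {1})" "g holomorphic_on (- {1})"
    and "\<And>s. Re s > 1 \<Longrightarrow> f s = g s" and "s \<noteq> 1"
  shows "f s = g s"
proof (rule analytic_continuation_open[of "{s. Re s > 1}" "- {1}" f g])
  show "{s :: complex. Re s > 1} \<noteq> {}" by (auto intro!: exI[of _ 2])
  show "connected (- {1 :: complex})" by (rule connected_punctured_universe) simp
qed (use assms in \<open>auto intro!: open_halfspace_Re_gt\<close>)

text \<open>This discharges the \<open>THE\<close>: uniqueness is the identity theorem on the
  connected punctured plane.\<close>

lemma riemann_zeta_eq_continuation: "riemann_zeta = zeta_continuation"
  unfolding riemann_zeta_def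
proof (rule the_equality)
  show "zeta_continuation holomorphic_on - {1} \<and>
      (\<forall>s. Re s > 1 \<longrightarrow> (\<lambda>n. 1 / of_nat (Suc n) powr s) sums zeta_continuation s) \<and>
      zeta_continuation 1 = 0"
    using holomorphic_zeta_continuation zeta_continuation_sums by (simp add: zeta_continuation_def)
  fix f assume f: "f holomorphic_on - {1} \<and>
      (\<forall>s. Re s > 1 \<longrightarrow> (\<lambda>n. 1 / of_nat (Suc n) powr s) sums f s) \<and> f 1 = 0"
  show "f = zeta_continuation"
  proof
    fix s
    show "f s = zeta_continuation s"
    proof (cases "s = 1")
      case True
      then show ?thesis using f by (simp add: zeta_continuation_def)
    next
      case False
      show ?thesis
      proof (rule analytic_continuation_punctured[OF _ holomorphic_zeta_continuation _ False])
        fix z :: complex assume z: "Re z > 1"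
        show "f z = zeta_continuation z"
          using f z sums_unique2[OF _ zeta_continuation_sums[OF z]] by blast
      qed (use f in blast)
    qed
  qed
qed

lemma polylog_eq_riemann_zeta:
  assumes "s \<noteq> 1"
  shows "polylog (-1) s = (1 - 2 powr (1 - s)) * riemann_zeta s"
proof (cases "2 powr (1 - s) = 1")
  case True
  \<comment> \<open>Here the right side is 0, and \<open>eta_cross_eq\<close> with a nonzero base-3
    factor forces \<open>eta 2 s = 0\<close>.\<close>
  then have "3 powr (1 - s) \<noteq> 1" using assms powr_two_three_eq_1[of "1 - s"] by auto
  with True show ?thesis using eta_cross_eq[of s] by (simp add: eta_two)
next
  case False
  then show ?thesis
    using assms by (simp add: riemann_zeta_eq_continuation zeta_continuation_def eta_two)
qed

text \<open>At k = 1 the limiting value is found by continuity of the entire function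
  \<open>polylog (-1)\<close>, which agrees with the product near 1.\<close>

lemma zeta_factor_eq_polylog: "zeta_factor k = polylog (-1) (of_nat k)"
proof (cases "k = 1")
  case True
  have "polylog (-1) holomorphic_on UNIV"
    by (rule holomorphic_polylog) auto
  then have "isCont (polylog (-1)) 1"
    using holomorphic_on_imp_continuous_on continuous_on_eq_continuous_at open_UNIV by blast
  then have "(polylog (-1) \<longlongrightarrow> polylog (-1) 1) (at 1)"
    by (simp add: isCont_def)
  then have "((\<lambda>s. (1 - 2 powr (1 - s)) * riemann_zeta s) \<longlongrightarrow> polylog (-1) 1) (at 1)"
    by (rule Lim_transform_eventually)
       (auto simp: eventually_at_filter polylog_eq_riemann_zeta)
  then show ?thesis
    using True by (simp add: zeta_factor_def tendsto_Lim)
next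
  case False
  then show ?thesis
    using polylog_eq_riemann_zeta[of "of_nat k"] by (simp add: zeta_factor_def)
qed

section \<open>The Newton series\<close>

lemma newton_P_0 [simp]: "newton_P 0 s = 1"
  by (simp add: newton_P_def)

lemma newton_P_Suc: "newton_P (Suc n) s = newton_P n s * ((of_nat n - s) / of_nat (Suc n))"
  by (simp add: newton_P_def gbinomial_prod_rev field_simps del: of_nat_Suc)

lemma newton_P_of_nat: "newton_P k (of_nat n) = (-1) ^ k * of_nat (n choose k)"
  by (simp add: newton_P_def binomial_gbinomial)

text \<open>The value is the binomial coefficient (N+n-1 choose n), hence nonnegative.\<close>

lemma newton_P_minus_of_nat: "newton_P n (- of_nat N) = of_real (norm (newton_P n (- of_nat N)))"
proof (induction n)
  case (Suc n)
  have eq: "(of_nat n - (- of_nat N)) / of_nat (Suc n) = complex_of_real (real (n + N) / real (Suc n))"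
    by simp
  show ?case
    unfolding newton_P_Suc eq norm_mult
    by (subst Suc.IH) (simp only: of_real_mult norm_of_real abs_of_nonneg of_nat_0_le_iff divide_nonneg_nonneg)
qed simp

text \<open>Factor by factor, |n - s| <= n + N: the point -N is extremal in the disc of radius
  \<open>N\<close>. It yields a majorant with the explicit generating function (1-w)^(-N).\<close>

lemma norm_newton_P_le:
  assumes "norm s \<le> real N"
  shows "norm (newton_P n s) \<le> norm (newton_P n (- of_nat N))"
proof (induction n)
  case (Suc n)
  have "norm (of_nat n - s) \<le> real (n + N)"
    using norm_triangle_ineq4[of "of_nat n" s] assms by simp
  also have "\<dots> = norm (of_nat n - (- of_nat N) :: complex)"
    by (metis norm_of_nat of_nat_add diff_minus_eq_add)
  finally show ?case
    unfolding newton_P_Suc norm_mult norm_divide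
    by (intro mult_mono Suc.IH divide_right_mono) auto
qed simp

text \<open>Consecutive values have ratio (n+N)/(n+1) <= 1 + N/(n+1) <= ((n+2)/(n+1))^N by
  Bernoulli's inequality, and these bounds telescope.\<close>

lemma norm_newton_P_minus_le: "norm (newton_P n (- of_nat N)) \<le> real (Suc n) ^ N"
proof (induction n)
  case (Suc n)
  define m where "m = real (Suc n)"
  have m: "m > 0" by (simp add: m_def)
  have "norm (of_nat n - (- of_nat N) :: complex) = real n + real N"
    by (metis norm_of_nat of_nat_add diff_minus_eq_add)
  then have "norm ((of_nat n - (- of_nat N)) / of_nat (Suc n) :: complex) = (real n + real N) / m"
    by (simp add: norm_divide m_def del: of_nat_Suc)
  also have "\<dots> \<le> 1 + real N * (1 / m)"
    using m by (simp add: m_def field_simps)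
  also have "\<dots> \<le> (1 + 1 / m) ^ N"
    using m by (intro Bernoulli_inequality) (simp add: order_trans[of "-1" 0])
  finally have "norm (newton_P (Suc n) (- of_nat N)) \<le> m ^ N * (1 + 1 / m) ^ N"
    unfolding newton_P_Suc norm_mult using Suc.IH m
    by (intro mult_mono) (auto simp: m_def)
  also have "\<dots> = (m * (1 + 1 / m)) ^ N" by (simp add: power_mult_distrib)
  also have "m * (1 + 1 / m) = real (Suc (Suc n))"
    using m by (simp add: m_def field_simps)
  finally show ?case .
qed simp

lemma newton_P_sums:
  assumes "norm w < 1"
  shows "(\<lambda>n. newton_P n s * w ^ n) sums (1 - w) powr s"
  using gen_binomial_complex[of "-w" s] assms
  by (simp add: newton_P_def power_minus[of w] mult_ac)

lemma inverse_of_nat_powr: "(1 / of_nat (Suc i) :: complex) powr s = of_nat (Suc i) powr (-s)"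
proof -
  have "Ln (1 / of_nat (Suc i)) = of_real (ln (1 / real (Suc i)))"
    using Ln_of_real[of "1 / real (Suc i)"] by simp
  also have "\<dots> = - of_real (ln (real (Suc i)))"
    by (simp add: ln_div del: of_nat_Suc)
  also have "of_real (ln (real (Suc i))) = Ln (of_nat (Suc i))"
    using Ln_of_real[of "real (Suc i)"] by simp
  finally show ?thesis by (simp add: powr_def del: of_nat_Suc)
qed

lemma newton_P_sums_powr:
  "(\<lambda>n. newton_P n s * (1 - 1 / of_nat (Suc i)) ^ n) sums of_nat (Suc i) powr (-s)"
proof -
  have "1 - 1 / of_nat (Suc i) = complex_of_real (1 - 1 / real (Suc i))" by simp
  also have "norm \<dots> = 1 - 1 / real (Suc i)"
    unfolding norm_of_real by (simp add: field_simps)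
  finally have "norm (1 - 1 / of_nat (Suc i) :: complex) < 1" by simp
  from newton_P_sums[OF this, of s] show ?thesis
    by (simp only: diff_diff_eq2 add_diff_cancel_left' inverse_of_nat_powr)
qed

lemma norm_newton_P_minus_sums:
  "(\<lambda>n. norm (newton_P n (- of_nat N)) * (1 - 1 / real (Suc i)) ^ n) sums real (Suc i) ^ N"
proof -
  have "(\<lambda>n. complex_of_real (norm (newton_P n (- of_nat N)) * (1 - 1 / real (Suc i)) ^ n))
      = (\<lambda>n. newton_P n (- of_nat N) * (1 - 1 / of_nat (Suc i)) ^ n)"
    by (subst newton_P_minus_of_nat) simp
  moreover have "of_nat (Suc i) powr (- (- of_nat N)) = complex_of_real (real (Suc i) ^ N)"
    by (simp add: powr_nat' del: of_nat_Suc)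
  ultimately have "(\<lambda>n. complex_of_real (norm (newton_P n (- of_nat N)) * (1 - 1 / real (Suc i)) ^ n))
      sums complex_of_real (real (Suc i) ^ N)"
    using newton_P_sums_powr[of "- of_nat N" i] by (simp only:)
  then show ?thesis by (simp only: sums_of_real_iff)
qed

section \<open>Newton expansion of Abel sums and passage to the limit\<close>

lemma holomorphic_one_minus_inverse_power:
  "(\<lambda>z :: complex. (1 - 1 / z) ^ n) holomorphic_on {z. Re z > 0}"
  by (intro holomorphic_intros) auto

lemma summable_abel_sum_one_minus_inverse_power:
  assumes "norm x < 1" "x \<noteq> 0"
  shows "summable (\<lambda>i. norm (x ^ i * (1 - 1 / of_nat (Suc i)) ^ n :: complex))"
proof (rule summable_abel_sum[OF _ assms])
  show "norm ((1 - 1 / z) ^ n) \<le> exp 1 * fact 0 * 6 ^ 0 / real (Suc n) ^ 0 * norm z ^ 0"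
    if "z \<in> sector" for z :: complex
    by (rule norm_one_minus_inverse_power_le_sector[OF that])
qed

text \<open>An interchange in the double series over i and n. The majorant \<open>G\<close> replaces
  s by -N; its row sums are |x|^i (i+1)^N, which are summable because |x| < 1.\<close>

lemma newton_expansion_abel_sum:
  assumes "norm x < 1" "x \<noteq> 0"
  shows "(\<lambda>n. newton_P n s * abel_sum x (\<lambda>z. (1 - 1 / z) ^ n)) sums abel_sum x (\<lambda>z. z powr (-s))"
proof -
  define N where "N = nat \<lceil>norm s\<rceil>"
  have N: "norm s \<le> real N" by (simp add: N_def of_nat_ceiling)
  define v where "v i = 1 - 1 / real (Suc i)" for i
  have v: "v i \<ge> 0" for i by (simp add: v_def field_simps)
  have norm_v: "norm (1 - 1 / of_nat (Suc i) :: complex) = v i" for i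
  proof -
    have "1 - 1 / of_nat (Suc i) = complex_of_real (v i)" by (simp add: v_def)
    then show ?thesis using v[of i] by (simp only: norm_of_real abs_of_nonneg)
  qed
  define F where "F = (\<lambda>(i, n). x ^ i * (newton_P n s * (1 - 1 / of_nat (Suc i)) ^ n))"
  define G where "G = (\<lambda>(i, n). norm x ^ i * (norm (newton_P n (- of_nat N)) * v i ^ n))"
  have G_row: "(\<lambda>n. G (i, n)) sums (norm x ^ i * real (Suc i) ^ N)" for i
    unfolding G_def v_def split by (intro sums_mult norm_newton_P_minus_sums)
  have G_nonneg: "G z \<ge> 0" for z
    using v by (auto simp: G_def split: prod.split)
  have FG: "norm (F z) \<le> G z" for z
    unfolding F_def G_def
    by (auto simp: norm_mult norm_power norm_v v simp del: of_nat_Suc split: prod.split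
          intro!: mult_left_mono mult_right_mono norm_newton_P_le N)
  have "G summable_on (UNIV \<times> UNIV)"
  proof (rule summable_on_SigmaI)
    show "((\<lambda>n. G (i, n)) has_sum (norm x ^ i * real (Suc i) ^ N)) UNIV" for i
      using G_row[of i] G_nonneg
      by (intro norm_summable_imp_has_sum) (auto dest: sums_summable)
    show "(\<lambda>i. norm x ^ i * real (Suc i) ^ N) summable_on UNIV"
      using summable_power_times_polynomial[of "norm x" N] assms
      by (subst summable_on_UNIV_nonneg_real_iff) auto
  qed (use G_nonneg in auto)
  then have "(\<lambda>z. norm (F z)) summable_on (UNIV \<times> UNIV)"
    by (rule summable_on_comparison_test) (use FG in auto)
  then have "F summable_on (UNIV \<times> UNIV)"
    by (rule abs_summable_summable)
  then obtain S where S: "(F has_sum S) (UNIV \<times> UNIV)"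
    unfolding summable_on_def by blast
  have "((\<lambda>i. x ^ i * of_nat (Suc i) powr (-s)) has_sum S) UNIV"
  proof (rule has_sum_SigmaD[OF S])
    fix i
    have "summable (\<lambda>n. norm (F (i, n)))"
      by (rule summable_comparison_test'[OF sums_summable[OF G_row[of i]]]) (use FG in auto)
    moreover have "(\<lambda>n. F (i, n)) sums (x ^ i * of_nat (Suc i) powr (-s))"
      unfolding F_def split by (intro sums_mult newton_P_sums_powr)
    ultimately show "((\<lambda>n. F (i, n)) has_sum (x ^ i * of_nat (Suc i) powr (-s))) UNIV"
      by (rule norm_summable_imp_has_sum)
  qed
  then have "abel_sum x (\<lambda>z. z powr (-s)) = S"
    unfolding abel_sum_def by (intro sums_unique[symmetric] has_sum_imp_sums)
  moreover have "((\<lambda>n. newton_P n s * abel_sum x (\<lambda>z. (1 - 1 / z) ^ n)) has_sum S) UNIV"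
  \<comment> \<open>The same family is now summed over i first.\<close>
  proof (rule has_sum_SigmaD[OF S[unfolded has_sum_swap[of F]]])
    fix n
    note * = summable_abel_sum_one_minus_inverse_power[OF assms, of n]
    have "((\<lambda>i. x ^ i * (1 - 1 / of_nat (Suc i)) ^ n) has_sum abel_sum x (\<lambda>z. (1 - 1 / z) ^ n)) UNIV"
      unfolding abel_sum_def
      by (intro norm_summable_imp_has_sum summable_sums * summable_norm_cancel[OF *])
    then have "((\<lambda>i. newton_P n s * (x ^ i * (1 - 1 / of_nat (Suc i)) ^ n))
        has_sum newton_P n s * abel_sum x (\<lambda>z. (1 - 1 / z) ^ n)) UNIV"
      by (rule has_sum_cmult_right)
    then show "((\<lambda>i. case (n, i) of (i, n) \<Rightarrow> F (n, i)) has_sum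
        newton_P n s * abel_sum x (\<lambda>z. (1 - 1 / z) ^ n)) UNIV"
      by (simp add: F_def mult.left_commute del: of_nat_Suc)
  qed
  ultimately show ?thesis by (simp add: has_sum_imp_sums)
qed

lemma abel_sum_one_minus_inverse_power:
  assumes "norm x < 1" "x \<noteq> 0"
  shows "abel_sum x (\<lambda>z. (1 - 1 / z) ^ n)
       = (\<Sum>k=0..n. newton_P k (of_nat n) * abel_sum x (\<lambda>z. z powr (- of_nat k)))"
proof -
  have binom: "(1 - 1 / of_nat (Suc i)) ^ n
      = (\<Sum>k=0..n. newton_P k (of_nat n) * of_nat (Suc i) powr (- of_nat k))" for i
  proof -
    have "(1 - 1 / of_nat (Suc i) :: complex) ^ n = (- (1 / of_nat (Suc i)) + 1) ^ n" by simp
    also have "\<dots> = (\<Sum>k\<le>n. of_nat (n choose k) * (- (1 / of_nat (Suc i))) ^ k)"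
      by (subst binomial_ring) simp
    also have "\<dots> = (\<Sum>k=0..n. newton_P k (of_nat n) * of_nat (Suc i) powr (- of_nat k))"
    proof (intro sum.cong)
      fix k
      have "(of_nat (Suc i) :: complex) powr (- of_nat k) = (1 / of_nat (Suc i)) ^ k"
        unfolding inverse_of_nat_powr[symmetric] by (subst powr_nat') (auto simp del: of_nat_Suc)
      then show "of_nat (n choose k) * (- (1 / of_nat (Suc i))) ^ k
          = newton_P k (of_nat n) * of_nat (Suc i) powr (- of_nat k)"
        by (simp add: newton_P_of_nat power_minus[of "1 / of_nat (Suc i)"] del: of_nat_Suc)
    qed auto
    finally show ?thesis .
  qed
  have sm: "summable (\<lambda>i. x ^ i * of_nat (Suc i) powr (- of_nat k))" for k
    by (rule summable_norm_cancel[OF summable_abel_sum[OF norm_powr_le_sector assms]]) auto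
  have "abel_sum x (\<lambda>z. (1 - 1 / z) ^ n)
      = (\<Sum>i. \<Sum>k=0..n. newton_P k (of_nat n) * (x ^ i * of_nat (Suc i) powr (- of_nat k)))"
    unfolding abel_sum_def binom by (simp only: sum_distrib_left mult.left_commute)
  also have "\<dots> = (\<Sum>k=0..n. \<Sum>i. newton_P k (of_nat n) * (x ^ i * of_nat (Suc i) powr (- of_nat k)))"
    by (intro suminf_sum summable_mult sm)
  also have "\<dots> = (\<Sum>k=0..n. newton_P k (of_nat n) * abel_sum x (\<lambda>z. z powr (- of_nat k)))"
    unfolding abel_sum_def by (intro sum.cong suminf_mult sm refl)
  finally show ?thesis .
qed

lemma norm_abel_sum_one_minus_inverse_power_le:
  obtains C where "\<And>r n. r \<in> {0<..<1} \<Longrightarrow>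
    norm (abel_sum (- of_real r) (\<lambda>z. (1 - 1 / z) ^ n)) \<le> C / real (Suc n) ^ p"
proof
  \<comment> \<open>The Euler-sum estimate is linear in the growth constant \<open>B\<close>; all
    dependence on n sits in the factor (n+1)^(-p) of \<open>B\<close>, so \<open>D\<close> serves
    all r and n.\<close>
  define D where "D = (\<Sum>j<p + 2. fdiff_bound j p) + fdiff_bound (p + 2) p * (\<Sum>i. inverse (real (Suc i) ^ 2))"
  fix r :: real and n :: nat assume r: "r \<in> {0<..<1}"
  let ?f = "\<lambda>z :: complex. (1 - 1 / z) ^ n"
  let ?x = "- complex_of_real r"
  define B where "B = exp 1 * fact p * 6 ^ p / real (Suc n) ^ p"
  have "B \<ge> 0" by (simp add: B_def)
  have bd: "norm (?f z) \<le> B * norm z ^ p" if "z \<in> sector" for z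
    unfolding B_def by (rule norm_one_minus_inverse_power_le_sector[OF that])
  note f = holomorphic_one_minus_inverse_power bd \<open>B \<ge> 0\<close>
  have x: "norm ?x < 1" "?x \<noteq> 0" "?x \<noteq> 1" "norm (1 - ?x) \<ge> 1"
  proof -
    show "norm ?x < 1" "?x \<noteq> 0" using r by auto
    then show "?x \<noteq> 1" by force
    have "1 - ?x = of_real (1 + r)" by simp
    then show "norm (1 - ?x) \<ge> 1" using r by (simp only: norm_of_real) auto
  qed
  have "norm (abel_sum ?x ?f) = norm (euler_sum (p + 2) ?f ?x)"
    using abel_sum_eq_euler_sum[OF summable_norm_cancel[OF summable_abel_sum_one_minus_inverse_power[OF x(1,2)]] x(2,3)]
    by simp
  also have "\<dots> \<le> (\<Sum>j<p + 2. norm ((fdiff ^^ j) ?f 1)) + (\<Sum>i. norm ((fdiff ^^ (p + 2)) ?f (of_nat (Suc i))))"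
    using x by (intro norm_euler_sum_le summable_fdiff[OF f]) auto
  also have "\<dots> \<le> (\<Sum>j<p + 2. fdiff_bound j p * B) + (\<Sum>i. fdiff_bound (p + 2) p * B * inverse (real (Suc i) ^ 2))"
  proof (intro add_mono sum_mono suminf_le)
    \<comment> \<open>At the base point 1, that is \<open>i = 0\<close>, the powers of the base
      point are 1.\<close>
    show "norm ((fdiff ^^ j) ?f 1) \<le> fdiff_bound j p * B" for j
      using norm_fdiff_le_power[OF f, of j 0] by (simp add: fdiff_bound_def)
    show "norm ((fdiff ^^ (p + 2)) ?f (of_nat (Suc i))) \<le> fdiff_bound (p + 2) p * B * inverse (real (Suc i) ^ 2)" for i
      by (rule norm_fdiff_le_inverse_square[OF f])
    show "summable (\<lambda>i. norm ((fdiff ^^ (p + 2)) ?f (of_nat (Suc i))))"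
      by (rule summable_fdiff[OF f])
    show "summable (\<lambda>i. fdiff_bound (p + 2) p * B * inverse (real (Suc i) ^ 2))"
      by (intro summable_mult summable_inverse_square_Suc)
  qed
  also have "\<dots> = D * B"
    unfolding D_def suminf_mult[OF summable_inverse_square_Suc]
    by (simp only: sum_distrib_right[symmetric] distrib_right) (simp only: mult_ac)
  finally show "norm (abel_sum ?x ?f) \<le> D * (exp 1 * fact p * 6 ^ p) / real (Suc n) ^ p"
    by (simp add: B_def)
qed

lemma newton_expansion_polylog:
  "(\<lambda>n. newton_P n s * (\<Sum>k=0..n. newton_P k (of_nat n) * polylog (-1) (of_nat k))) sums polylog (-1) s"
proof -
  define N where "N = nat \<lceil>norm s\<rceil>"
  have N: "norm s \<le> real N" by (simp add: N_def of_nat_ceiling)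
  define a where "a n r = newton_P n s * abel_sum (- of_real r) (\<lambda>z. (1 - 1 / z) ^ n)" for n and r :: real
  define b where "b n = newton_P n s * (\<Sum>k=0..n. newton_P k (of_nat n) * polylog (-1) (of_nat k))" for n
  \<comment> \<open>The Newton polynomials are bounded by (n+1)^N, so decay of order N + 2 leaves
    the majorant C/(n+1)^2.\<close>
  obtain C where C: "\<And>r n. r \<in> {0<..<1} \<Longrightarrow>
      norm (abel_sum (- of_real r) (\<lambda>z. (1 - 1 / z) ^ n)) \<le> C / real (Suc n) ^ (N + 2)"
    using norm_abel_sum_one_minus_inverse_power_le by blast
  have r01: "eventually (\<lambda>r. r \<in> {0<..<(1::real)}) (at_left 1)"
    by (rule eventually_at_left_real) simp
  have lim: "((\<lambda>r. abel_sum (- of_real r) (\<lambda>z. z powr (-t))) \<longlongrightarrow> polylog (-1) t) (at_left 1)" for t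
    using tendsto_polylog[of "-1" t] by simp
  have small: "norm (- complex_of_real r) < 1" "- complex_of_real r \<noteq> 0" if "r \<in> {0<..<1}" for r
    using that by auto
  have ab: "(a n \<longlongrightarrow> b n) (at_left 1)" for n
  proof (rule Lim_transform_eventually)
    show "((\<lambda>r. newton_P n s * (\<Sum>k=0..n. newton_P k (of_nat n) *
        abel_sum (- of_real r) (\<lambda>z. z powr (- of_nat k)))) \<longlongrightarrow> b n) (at_left 1)"
      unfolding b_def by (intro tendsto_intros lim)
    show "\<forall>\<^sub>F r in at_left 1. newton_P n s * (\<Sum>k=0..n. newton_P k (of_nat n) *
        abel_sum (- of_real r) (\<lambda>z. z powr (- of_nat k))) = a n r"
      using r01 by eventually_elim (simp only: a_def abel_sum_one_minus_inverse_power[OF small])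
  qed
  have bound: "norm (a n r) \<le> C * inverse (real (Suc n) ^ 2)" if "r \<in> {0<..<1}" for n r
  proof -
    define m where "m = real (Suc n)"
    have m: "m > 0" by (simp add: m_def)
    have "norm (a n r) \<le> m ^ N * (C / m ^ (N + 2))"
      unfolding a_def norm_mult m_def
      using norm_newton_P_minus_le[of n N]
      by (intro mult_mono C that order_trans[OF norm_newton_P_le[OF N]]) auto
    also have "\<dots> = C * inverse (m ^ 2)" using m by (simp add: power_add field_simps power2_eq_square)
    finally show ?thesis by (simp only: m_def)
  qed
  have "eventually (\<lambda>(n, r). norm (a n r) \<le> C * inverse (real (Suc n) ^ 2)) (at_top \<times>\<^sub>F at_left 1)"
    by (rule eventually_mono[OF eventually_prodI[OF always_eventually[of "\<lambda>_. True"] r01]])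
       (use bound in auto)
  \<comment> \<open>Tannery's theorem provides both the summability of the limit terms and the
    exchange of limit and sum.\<close>
  from tannerys_theorem[OF ab this summable_mult[OF summable_inverse_square_Suc]]
  have sm: "summable (\<lambda>n. norm (b n))" and "((\<lambda>r. \<Sum>n. a n r) \<longlongrightarrow> suminf b) (at_left 1)"
    by auto
  moreover have "((\<lambda>r. \<Sum>n. a n r) \<longlongrightarrow> polylog (-1) s) (at_left 1)"
  proof (rule Lim_transform_eventually[OF lim[of s]])
    show "\<forall>\<^sub>F r in at_left 1. abel_sum (- of_real r) (\<lambda>z. z powr - s) = (\<Sum>n. a n r)"
      using r01
      by eventually_elim (unfold a_def, intro sums_unique newton_expansion_abel_sum small)
  qed
  ultimately have "suminf b = polylog (-1) s"
    using tendsto_unique[of "at_left (1::real)"] by (metis trivial_limit_at_left_real)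
  then have "b sums polylog (-1) s"
    using summable_sums[OF summable_norm_cancel[OF sm]] by (simp only:)
  then show ?thesis by (simp only: b_def[abs_def])
qed

theorem theorem5:
  fixes s :: complex
  assumes "2 powr (1 - s) \<noteq> 1"
  shows "(\<lambda>n. (\<Sum>k=0..n. newton_P k (of_nat n) * (zeta_factor k / (1 - 2 powr (1 - s))))
            * newton_P n s) sums riemann_zeta s"
proof -
  have "s \<noteq> 1" using assms by auto
  then have "riemann_zeta s = polylog (-1) s / (1 - 2 powr (1 - s))"
    using polylog_eq_riemann_zeta[of s] assms by simp
  moreover have "(\<Sum>k=0..n. newton_P k (of_nat n) * (zeta_factor k / (1 - 2 powr (1 - s)))) * newton_P n s
      = newton_P n s * (\<Sum>k=0..n. newton_P k (of_nat n) * polylog (-1) (of_nat k)) / (1 - 2 powr (1 - s))" for n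
    by (simp add: zeta_factor_eq_polylog mult.commute[of _ "newton_P n s"] flip: sum_divide_distrib)
  ultimately show ?thesis
    using sums_divide[OF newton_expansion_polylog[of s], of "1 - 2 powr (1 - s)"]
    by (simp only:)
qed

end
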